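(* For every $r\in[0,1]$ there exists a $2\times2$ unitary matrix $u\in\mathbb{M}_2(\mathbb{C})$ such that $$\mathrm{d}_{\mathrm{KK}}(\Delta,u\Delta u^* )=r.$$
   Context: $\Delta$ denotes the algebra of diagonal matrices in $\mathbb{M}_2(\mathbb{C})$. Kadison--Kastler distance: for subspaces $\mathcal{Y},\mathcal{Z}$ of a normed space (here $\mathbb{M}_2(\mathbb{C})$ with the operator norm), with closed unit balls $(\mathcal{Y})_1,(\mathcal{Z})_1$ and $d(x,S)=\inf\{\|x-s\|:s\in S\}$, $$\mathrm{d}_{\mathrm{KK}}(\mathcal{Y},\mathcal{Z})=\max\Big\{\sup_{y\in(\mathcal{Y})_1}d(y,(\mathcal{Z})_1),\ \sup_{z\in(\mathcal{Z})_1}d(z,(\mathcal{Y})_1)\Big\}.$$ *)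

theory Defs
  imports "HOL-Analysis.Analysis"
begin

text \<open>
  The library norm on \<^typ>\<open>complex^'n^'n\<close> is the Frobenius norm, not the operator norm, so
  the notions below take the norm \<open>N\<close> as an explicit argument.
\<close>

definition unit_ball_of :: "('a \<Rightarrow> real) \<Rightarrow> 'a set \<Rightarrow> 'a set"
  where "unit_ball_of N Y = {y \<in> Y. N y \<le> 1}"

definition dist_to_set :: "('a::ab_group_add \<Rightarrow> real) \<Rightarrow> 'a \<Rightarrow> 'a set \<Rightarrow> real"
  where "dist_to_set N x S = (INF s\<in>S. N (x - s))"

definition kk_dist :: "('a::ab_group_add \<Rightarrow> real) \<Rightarrow> 'a set \<Rightarrow> 'a set \<Rightarrow> real"
  where "kk_dist N Y Z =
    max (SUP y\<in>unit_ball_of N Y. dist_to_set N y (unit_ball_of N Z))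
        (SUP z\<in>unit_ball_of N Z. dist_to_set N z (unit_ball_of N Y))"

text \<open>
  For sets containing \<open>0\<close> (in particular subspaces), the real-valued suprema and infima above
  are taken over nonempty bounded sets, so they are the usual ones.
\<close>

lemma unit_ball_of_nonempty:
  assumes "N 0 = 0" and "0 \<in> Y"
  shows "unit_ball_of N Y \<noteq> {}"
  using assms by (auto simp: unit_ball_of_def intro!: exI[of _ 0])

lemma dist_to_set_bdd_below:
  assumes "\<And>x. 0 \<le> N x"
  shows "bdd_below ((\<lambda>s. N (x - s)) ` S)"
  using assms by (auto intro!: bdd_belowI2[of _ 0])

lemma dist_to_set_unit_ball_bounds:
  fixes N :: "'a::ab_group_add \<Rightarrow> real"
  assumes N: "\<And>x. 0 \<le> N x" "N 0 = 0" and Z: "0 \<in> Z" and y: "y \<in> unit_ball_of N Y"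
  shows "dist_to_set N y (unit_ball_of N Z) \<in> {0..1}"
proof -
  have z: "0 \<in> unit_ball_of N Z"
    using N Z by (simp add: unit_ball_of_def)
  have "dist_to_set N y (unit_ball_of N Z) \<le> N (y - 0)"
    unfolding dist_to_set_def by (rule cINF_lower[OF dist_to_set_bdd_below[OF N(1)] z])
  moreover have "0 \<le> dist_to_set N y (unit_ball_of N Z)"
    unfolding dist_to_set_def using z N(1) by (intro cINF_greatest) auto
  ultimately show ?thesis
    using y by (simp add: unit_ball_of_def)
qed

lemma kk_dist_bdd_above:
  fixes N :: "'a::ab_group_add \<Rightarrow> real"
  assumes "\<And>x. 0 \<le> N x" "N 0 = 0" and "0 \<in> Z"
  shows "bdd_above ((\<lambda>y. dist_to_set N y (unit_ball_of N Z)) ` unit_ball_of N Y)"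
  using dist_to_set_unit_ball_bounds[of N Z, OF assms] by (auto intro!: bdd_aboveI2[of _ _ 1])

text \<open>
  The norm on \<^typ>\<open>complex^'n\<close> is the Hilbert space norm, so this is the operator norm on
  complex matrices acting on the Hilbert space of column vectors.
\<close>

definition op_norm :: "complex^'n^'n \<Rightarrow> real"
  where "op_norm A = onorm ((*v) A)"

definition conj_transpose :: "complex^'n^'m \<Rightarrow> complex^'m^'n"
  where "conj_transpose A = map_matrix cnj (transpose A)"

definition unitary_matrix :: "complex^'n^'n \<Rightarrow> bool"
  where "unitary_matrix u \<longleftrightarrow> conj_transpose u ** u = mat 1 \<and> u ** conj_transpose u = mat 1"

definition diagonal_matrices :: "(complex^'n^'n) set"
  where "diagonal_matrices = {A. \<forall>i j. i \<noteq> j \<longrightarrow> A $ i $ j = 0}"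

end

theory Submission
  imports Defs
begin

text \<open>
  Take \<open>u\<close> to be the self-adjoint reflection with rows \<open>(cos \<theta>, sin \<theta>)\<close> and
  \<open>(sin \<theta>, - cos \<theta>)\<close>, where \<open>sin (2\<theta>) = r\<close>. Conjugation by \<open>u\<close> is an isometric involution exchanging
  \<open>\<Delta>\<close> and \<open>u\<Delta>u\<^sup>*\<close>, so the two suprema agree and only distances from \<open>\<Delta>\<close> matter. For
  \<open>y = diag(a, b)\<close> both off-diagonal entries of \<open>uyu\<close> are \<open>(a - b) sin \<theta> cos \<theta>\<close>. Removing them is a
  contraction, so it yields a point of the unit ball of \<open>u\<Delta>u\<^sup>*\<close> within \<open>2 sin \<theta> cos \<theta> = r\<close> of \<open>y\<close>.
  For \<open>y = diag(1, -1)\<close> no point is nearer, because the operator norm dominates every entry.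
\<close>

lemma norm_mult_vec_le_op_norm:
  fixes A :: "complex^'n^'n"
  shows "norm (A *v x) \<le> op_norm A * norm x"
  unfolding op_norm_def by (rule onorm) (rule matrix_vector_mul_bounded_linear)

lemma op_norm_le:
  fixes A :: "complex^'n^'n"
  assumes "\<And>x. norm (A *v x) \<le> t * norm x"
  shows "op_norm A \<le> t"
  unfolding op_norm_def by (rule onorm_le) (rule assms)

lemma op_norm_nonneg: "0 \<le> op_norm A" for A :: "complex^'n^'n"
  unfolding op_norm_def by (rule onorm_pos_le) (rule matrix_vector_mul_bounded_linear)

lemma op_norm_zero: "op_norm (0 :: complex^'n^'n) = 0"
  using op_norm_le[of "0 :: complex^'n^'n" 0] op_norm_nonneg[of "0 :: complex^'n^'n"] by simp

lemma op_norm_mult_le: "op_norm (A ** B) \<le> op_norm A * op_norm B" for A B :: "complex^'n^'n"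
  unfolding op_norm_def matrix_compose[symmetric]
  using onorm_compose[of "(*v) A" "(*v) B"]
  by (simp add: o_def matrix_vector_mul_assoc)

text \<open>The entry is a coordinate of the image of a standard basis vector, which has norm
  1.\<close>

lemma norm_entry_le_op_norm: "norm (A $ i $ j) \<le> op_norm A" for A :: "complex^'n^'n"
proof -
  have "A $ i $ j = (A *v axis j 1) $ i"
    by (simp add: matrix_vector_mult_def axis_def if_distrib cong: if_cong)
  then have "norm (A $ i $ j) \<le> norm (A *v axis j 1)"
    by (simp add: Finite_Cartesian_Product.norm_nth_le)
  also have "\<dots> \<le> op_norm A"
    using norm_mult_vec_le_op_norm[of A "axis j 1"] by (simp add: norm_axis_1)
  finally show ?thesis .
qed

lemma diagonal_matrix_mult_vec_nth:
  fixes D :: "complex^'n^'n"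
  assumes "D \<in> diagonal_matrices"
  shows "(D *v x) $ i = D $ i $ i * x $ i"
proof -
  have "(D *v x) $ i = (\<Sum>j\<in>UNIV. if j = i then D $ i $ i * x $ i else 0)"
    unfolding matrix_vector_mult_def vec_lambda_beta using assms
    by (intro sum.cong) (auto simp: diagonal_matrices_def)
  then show ?thesis by simp
qed

lemma op_norm_diagonal_le:
  fixes D :: "complex^'n^'n"
  assumes "D \<in> diagonal_matrices" and "0 \<le> t" and "\<And>i. norm (D $ i $ i) \<le> t"
  shows "op_norm D \<le> t"
proof (rule op_norm_le)
  fix x :: "complex^'n"
  have "norm (D *v x) \<le> norm (t *\<^sub>R x)"
    using assms by (intro norm_le_componentwise_cart)
      (simp add: diagonal_matrix_mult_vec_nth norm_mult mult_right_mono)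
  then show "norm (D *v x) \<le> t * norm x"
    using assms(2) by simp
qed

text \<open>The adjoint relation for the complex inner product, conjugate-linear in its first
  argument and written out as a sum. It makes unitary matrices isometric.\<close>

lemma sum_cnj_mult_vec:
  fixes A :: "complex^'n^'n"
  shows "(\<Sum>i\<in>UNIV. cnj ((A *v x) $ i) * y $ i) =
    (\<Sum>j\<in>UNIV. cnj (x $ j) * (conj_transpose A *v y) $ j)"
proof -
  have "(\<Sum>i\<in>UNIV. cnj ((A *v x) $ i) * y $ i) =
      (\<Sum>i\<in>UNIV. \<Sum>j\<in>UNIV. cnj (x $ j) * (cnj (A $ i $ j) * y $ i))"
    by (simp add: matrix_vector_mult_def sum_distrib_left sum_distrib_right mult_ac)
  also have "\<dots> = (\<Sum>j\<in>UNIV. \<Sum>i\<in>UNIV. cnj (x $ j) * (cnj (A $ i $ j) * y $ i))"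
    by (rule sum.swap)
  also have "\<dots> = (\<Sum>j\<in>UNIV. cnj (x $ j) * (conj_transpose A *v y) $ j)"
    by (simp add: matrix_vector_mult_def conj_transpose_def map_matrix_def transpose_def
        sum_distrib_left)
  finally show ?thesis .
qed

lemma norm_unitary_mult_vec:
  fixes u :: "complex^'n^'n"
  assumes "unitary_matrix u"
  shows "norm (u *v x) = norm x"
proof -
  have sq: "complex_of_real ((norm y)\<^sup>2) = (\<Sum>i\<in>UNIV. cnj (y $ i) * y $ i)" for y :: "complex^'n"
    by (simp add: norm_vec_def L2_set_def sum_nonneg complex_norm_square mult.commute
        del: of_real_power)
  have "complex_of_real ((norm (u *v x))\<^sup>2) = complex_of_real ((norm x)\<^sup>2)"
    unfolding sq sum_cnj_mult_vec using assms
    by (simp add: unitary_matrix_def matrix_vector_mul_assoc)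
  then show ?thesis
    by (simp only: of_real_eq_iff) simp
qed

lemma op_norm_unitary_le_1: "unitary_matrix u \<Longrightarrow> op_norm u \<le> 1"
  by (rule op_norm_le) (simp add: norm_unitary_mult_vec)

lemma kk_dist_involution:
  assumes N: "\<And>x. N (f x) = N x" and diff: "\<And>x y. f (x - y) = f x - f y"
    and inv: "\<And>x. f (f x) = x"
  shows "kk_dist N Y (f ` Y) = (SUP y\<in>unit_ball_of N Y. dist_to_set N y (unit_ball_of N (f ` Y)))"
proof -
  have ball: "unit_ball_of N (f ` Y) = f ` unit_ball_of N Y"
    by (auto simp: unit_ball_of_def N)
  have "N (f y - s) = N (y - f s)" for y s
    by (metis N diff inv)
  then have "dist_to_set N (f y) (unit_ball_of N Y) = dist_to_set N y (f ` unit_ball_of N Y)" for y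
    by (simp add: dist_to_set_def image_comp o_def)
  then show ?thesis
    by (simp add: kk_dist_def ball image_comp o_def)
qed

definition reflection :: "real \<Rightarrow> complex^2^2"
  where "reflection \<theta> =
    vector [vector [of_real (cos \<theta>), of_real (sin \<theta>)], vector [of_real (sin \<theta>), - of_real (cos \<theta>)]]"

lemma reflection_nth:
  "reflection \<theta> $ 1 $ 1 = of_real (cos \<theta>)" "reflection \<theta> $ 1 $ 2 = of_real (sin \<theta>)"
  "reflection \<theta> $ 2 $ 1 = of_real (sin \<theta>)" "reflection \<theta> $ 2 $ 2 = - of_real (cos \<theta>)"
  by (simp_all add: reflection_def)

lemma conj_transpose_reflection: "conj_transpose (reflection \<theta>) = reflection \<theta>"
  by (simp add: vec_eq_iff forall_2 conj_transpose_def map_matrix_def transpose_def reflection_nth)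

lemma reflection_mult_self: "reflection \<theta> ** reflection \<theta> = mat 1"
proof -
  have "complex_of_real (cos \<theta>) * of_real (cos \<theta>) + of_real (sin \<theta>) * of_real (sin \<theta>) = 1"
    by (simp flip: of_real_mult of_real_add)
  then show ?thesis
    by (simp add: vec_eq_iff forall_2 matrix_matrix_mult_def sum_2 mat_def reflection_nth
        mult.commute add.commute)
qed

lemma unitary_reflection: "unitary_matrix (reflection \<theta>)"
  by (simp add: unitary_matrix_def conj_transpose_reflection reflection_mult_self)

text \<open>Since \<open>reflection \<theta>\<close> is its own adjoint, this is conjugation by a
  unitary.\<close>

definition reflect :: "real \<Rightarrow> complex^2^2 \<Rightarrow> complex^2^2"
  where "reflect \<theta> A = reflection \<theta> ** A ** reflection \<theta>"

lemma reflect_reflect: "reflect \<theta> (reflect \<theta> A) = A"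
proof -
  have "reflect \<theta> (reflect \<theta> A) = (reflection \<theta> ** reflection \<theta>) ** A ** (reflection \<theta> ** reflection \<theta>)"
    unfolding reflect_def by (simp only: matrix_mul_assoc)
  then show ?thesis by (simp add: reflection_mult_self)
qed

lemma reflect_diff: "reflect \<theta> (A - B) = reflect \<theta> A - reflect \<theta> B"
  by (simp add: reflect_def matrix_matrix_mult_def vec_eq_iff sum_2 algebra_simps)

text \<open>Submultiplicativity gives one inequality; applied to \<open>reflect \<theta> A\<close>,
  it gives the other by involutivity.\<close>

lemma op_norm_reflect: "op_norm (reflect \<theta> A) = op_norm A"
proof -
  have *: "op_norm (reflect \<theta> B) \<le> op_norm B" for B
  proof -
    have "op_norm (reflect \<theta> B) \<le> op_norm (reflection \<theta>) * op_norm B * op_norm (reflection \<theta>)"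
      unfolding reflect_def
      by (intro order_trans[OF op_norm_mult_le] mult_right_mono op_norm_mult_le op_norm_nonneg)
    also have "\<dots> \<le> 1 * op_norm B * 1"
      by (intro mult_mono op_norm_unitary_le_1 unitary_reflection op_norm_nonneg
          mult_nonneg_nonneg order_refl zero_le_one)
    finally show ?thesis by simp
  qed
  from *[of A] *[of "reflect \<theta> A"] show ?thesis
    by (simp add: reflect_reflect)
qed

lemma reflect_diagonal_off_diagonal:
  assumes "A \<in> diagonal_matrices" and "i \<noteq> j"
  shows "reflect \<theta> A $ i $ j = of_real (sin \<theta> * cos \<theta>) * (A $ 1 $ 1 - A $ 2 $ 2)"
  using assms exhaust_2[of i] exhaust_2[of j]
  by (auto simp: diagonal_matrices_def reflect_def matrix_matrix_mult_def sum_2 reflection_nth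
      algebra_simps)

text \<open>Swapping the coordinates, a unitary operation, reduces this to the diagonal
  case.\<close>

lemma op_norm_off_diagonal_le:
  fixes A :: "complex^2^2"
  assumes "\<And>i. A $ i $ i = 0" and "norm (A $ 1 $ 2) \<le> t" and "norm (A $ 2 $ 1) \<le> t"
  shows "op_norm A \<le> t"
proof -
  \<comment> \<open>Each row sum is the single off-diagonal entry of that row.\<close>
  define D :: "complex^2^2" where "D = (\<chi> i j. if i = j then \<Sum>k\<in>UNIV. A $ i $ k else 0)"
  \<comment> \<open>At angle \<open>\<pi>/2\<close> the reflection is the matrix that swaps the two coordinates.\<close>
  have A: "A = D ** reflection (pi / 2)"
    using assms(1)
    by (simp add: vec_eq_iff forall_2 matrix_matrix_mult_def sum_2 reflection_nth D_def)
  have t: "0 \<le> t" using assms(2) norm_ge_zero order_trans by blast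
  have D: "op_norm D \<le> t"
  proof (rule op_norm_diagonal_le[OF _ t])
    show "D \<in> diagonal_matrices" by (simp add: D_def diagonal_matrices_def)
    show "norm (D $ i $ i) \<le> t" for i
      using exhaust_2[of i] assms by (auto simp: D_def sum_2)
  qed
  have "op_norm A \<le> op_norm D * op_norm (reflection (pi / 2))"
    unfolding A by (rule op_norm_mult_le)
  also have "\<dots> \<le> t * 1"
    by (intro mult_mono D op_norm_unitary_le_1 unitary_reflection op_norm_nonneg t)
  finally show ?thesis by simp
qed

lemma kk_dist_diagonal_reflect:
  assumes "0 \<le> sin \<theta> * cos \<theta>"
  shows "kk_dist op_norm diagonal_matrices (reflect \<theta> ` diagonal_matrices) = 2 * (sin \<theta> * cos \<theta>)"
proof -
  let ?\<Delta> = "diagonal_matrices :: (complex^2^2) set"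
  let ?Z = "unit_ball_of op_norm (reflect \<theta> ` ?\<Delta>)"
  let ?r = "2 * (sin \<theta> * cos \<theta>)"
  define \<sigma> :: "complex^2^2" where "\<sigma> = (\<chi> i j. if i = j then if i = 1 then 1 else -1 else 0)"
  have \<sigma>: "\<sigma> \<in> unit_ball_of op_norm ?\<Delta>"
    by (auto simp: unit_ball_of_def \<sigma>_def diagonal_matrices_def intro!: op_norm_diagonal_le)
  \<comment> \<open>This makes \<open>?Z\<close> nonempty and the distances to it bounded on the
    unit ball of \<open>?\<Delta>\<close>.\<close>
  have zero: "0 \<in> reflect \<theta> ` ?\<Delta>"
    using reflect_diff[of \<theta> 0 0] by (force simp: diagonal_matrices_def)
  have upper: "dist_to_set op_norm y ?Z \<le> ?r" if y: "y \<in> unit_ball_of op_norm ?\<Delta>" for y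
  proof -
    have y': "y \<in> ?\<Delta>" "op_norm y \<le> 1" using y by (auto simp: unit_ball_of_def)
    let ?A = "reflect \<theta> y"
    \<comment> \<open>The diagonal part of \<open>?A\<close>. Its entries are bounded by
      \<open>op_norm ?A\<close>, so \<open>reflect \<theta> E\<close> lies in the unit ball and not
      merely in the subspace.\<close>
    define E :: "complex^2^2" where "E = (\<chi> i j. if i = j then ?A $ i $ i else 0)"
    have E: "E \<in> ?\<Delta>" by (simp add: E_def diagonal_matrices_def)
    have "op_norm E \<le> op_norm ?A"
      by (rule op_norm_diagonal_le[OF E op_norm_nonneg]) (simp add: E_def norm_entry_le_op_norm)
    then have ball: "reflect \<theta> E \<in> ?Z"
      using E y' by (simp add: unit_ball_of_def op_norm_reflect)
    have "norm (y $ 1 $ 1 - y $ 2 $ 2) \<le> 1 + 1"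
      using y'(2) by (intro order_trans[OF norm_triangle_ineq4] add_mono
          order_trans[OF norm_entry_le_op_norm]) auto
    then have "sin \<theta> * cos \<theta> * norm (y $ 1 $ 1 - y $ 2 $ 2) \<le> sin \<theta> * cos \<theta> * 2"
      using assms by (intro mult_left_mono) simp_all
    then have entry: "norm (?A $ i $ j) \<le> ?r" if "i \<noteq> j" for i j
      unfolding reflect_diagonal_off_diagonal[OF y'(1) that] norm_mult norm_of_real
      using assms by simp
    \<comment> \<open>Reflecting the difference leaves exactly the off-diagonal part of
      \<open>?A\<close>.\<close>
    have "op_norm (y - reflect \<theta> E) = op_norm (?A - E)"
      using op_norm_reflect[of \<theta> "y - reflect \<theta> E"] by (simp add: reflect_diff reflect_reflect)
    also have "\<dots> \<le> ?r"
      by (rule op_norm_off_diagonal_le) (simp_all add: E_def entry)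
    finally show ?thesis
      unfolding dist_to_set_def
      using cINF_lower[OF dist_to_set_bdd_below[of op_norm, OF op_norm_nonneg] ball]
      by (rule order_trans[rotated])
  qed
  have lower: "?r \<le> dist_to_set op_norm \<sigma> ?Z"
    unfolding dist_to_set_def
  proof (rule cINF_greatest)
    show "?Z \<noteq> {}" by (rule unit_ball_of_nonempty[of op_norm, OF op_norm_zero zero])
  next
    fix z assume "z \<in> ?Z"
    then obtain d where d: "d \<in> ?\<Delta>" "z = reflect \<theta> d" by (auto simp: unit_ball_of_def)
    \<comment> \<open>Subtracting the diagonal \<open>d\<close> cannot change this entry; the factor
      2 is the gap between the diagonal entries 1 and -1 of \<open>\<sigma>\<close>.\<close>
    have "(reflect \<theta> \<sigma> - d) $ 1 $ 2 = of_real (sin \<theta> * cos \<theta>) * 2"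
      using d \<sigma> reflect_diagonal_off_diagonal[of \<sigma> 1 2 \<theta>]
      by (simp add: diagonal_matrices_def unit_ball_of_def) (simp add: \<sigma>_def)
    then have "?r = norm ((reflect \<theta> \<sigma> - d) $ 1 $ 2)"
      using assms by (simp only: norm_mult norm_of_real) simp
    also have "\<dots> \<le> op_norm (reflect \<theta> \<sigma> - d)" by (rule norm_entry_le_op_norm)
    also have "\<dots> = op_norm (\<sigma> - z)"
      using op_norm_reflect[of \<theta> "\<sigma> - z"] by (simp add: d reflect_diff reflect_reflect)
    finally show "?r \<le> op_norm (\<sigma> - z)" .
  qed
  have "(SUP y\<in>unit_ball_of op_norm ?\<Delta>. dist_to_set op_norm y ?Z) = ?r"
  proof (rule antisym)
    show "(SUP y\<in>unit_ball_of op_norm ?\<Delta>. dist_to_set op_norm y ?Z) \<le> ?r"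
      using \<sigma> by (intro cSUP_least upper) auto
    show "?r \<le> (SUP y\<in>unit_ball_of op_norm ?\<Delta>. dist_to_set op_norm y ?Z)"
      by (rule cSUP_upper2[OF kk_dist_bdd_above[of op_norm, OF op_norm_nonneg op_norm_zero zero] \<sigma> lower])
  qed
  then show ?thesis
    by (simp add: kk_dist_involution[of op_norm, OF op_norm_reflect reflect_diff reflect_reflect])
qed

theorem corollary3p5:
  fixes r :: real
  assumes "r \<in> {0..1}"
  shows "\<exists>u :: complex^2^2. unitary_matrix u \<and>
    kk_dist op_norm diagonal_matrices ((\<lambda>a. u ** a ** conj_transpose u) ` diagonal_matrices) = r"
proof (intro exI conjI)
  let ?\<theta> = "arcsin r / 2"
  \<comment> \<open>By the double-angle formula the left side is \<open>sin (arcsin r)\<close>. As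
    \<open>r\<close> is nonnegative, so is \<open>sin ?\<theta> * cos ?\<theta>\<close>, as
    \<open>kk_dist_diagonal_reflect\<close> requires.\<close>
  have r: "2 * (sin ?\<theta> * cos ?\<theta>) = r"
    using assms sin_double[of ?\<theta>] by simp
  show "unitary_matrix (reflection ?\<theta>)" by (rule unitary_reflection)
  show "kk_dist op_norm diagonal_matrices
      ((\<lambda>a. reflection ?\<theta> ** a ** conj_transpose (reflection ?\<theta>)) ` diagonal_matrices) = r"
    using kk_dist_diagonal_reflect[of ?\<theta>] r assms
    by (simp add: conj_transpose_reflection reflect_def[abs_def])
qed

end
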